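(* Suppose that for each sign $\nu\in\{+,-\}$ the coefficients satisfy $\alpha_0^\nu\ge 0$, $\alpha_0^\nu+|\beta_0^\nu|>0$, $\nu\beta_0^\nu\ge 0$ (that is, $\beta_0^+\ge 0$ and $\beta_0^-\le 0$), and $$\left(\frac{\sum_{i=1}^{m^\nu}|\alpha_i^\nu|}{\alpha_0^\nu}\right)^2+\left(\frac{\sum_{i=1}^{m^\nu}|\beta_i^\nu|}{\beta_0^\nu}\right)^2<1,$$ with the convention that if a denominator is zero then the corresponding numerator must also be zero and the corresponding fraction is omitted. Suppose also that $\alpha_i^\nu\ge 0$ for all $\nu\in\{+,-\}$ and $i=1,\dots,m^\nu$. Then the principal eigenfunction $u_0$ (with suitable sign) of the multi-point eigenvalue problem satisfies: (a) $u_0>0$ on $(-1,1)$; (b) if $\beta_0^\nu\ne 0$ for some $\nu\in\{+,-\}$, then $u_0(\nu)>0$, where $u_0(\nu)$ denotes the value of $u_0$ at the end point $+1$ if $\nu=+$ and $-1$ if $\nu=-$.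
   Context: Data: integers $m^\pm\ge 1$; for each sign $\nu\in\{+,-\}$, numbers $\alpha_0^\nu,\beta_0^\nu\in\mathbb{R}$, $\alpha_i^\nu,\beta_i^\nu\in\mathbb{R}$ and $\eta_i^\nu\in[-1,1]$, $i=1,\dots,m^\nu$, with $\eta_i^+\ne 1$ and $\eta_i^-\neq -1$. The eigenvalue problem is $$-u''=\lambda u\ \text{ on }(-1,1),\qquad \alpha_0^\pm u(\pm1)+\beta_0^\pm u'(\pm 1)=\sum_{i=1}^{m^\pm}\alpha_i^\pm u(\eta_i^\pm)+\sum_{i=1}^{m^\pm}\beta_i^\pm u'(\eta_i^\pm)$$ (two boundary conditions, one for each sign), with $\lambda\in\mathbb{R}$, $u\in C^2[-1,1]$ real-valued. An eigenvalue is a $\lambda\in\mathbb R$ for which there is a non-trivial solution $u$ (an eigenfunction). Under the first group of hypotheses in the claim (without $\alpha_i^\nu\ge0$), the set of eigenvalues is a strictly increasing sequence $0\le\lambda_0<\lambda_1<\cdots$ tending to $\infty$, and each eigenvalue has a one-dimensional eigenspace. The principal eigenfunction $u_0$ is an eigenfunction of the smallest eigenvalue $\lambda_0$ (unique up to a nonzero scalar multiple). *)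

theory Defs
  imports "HOL-Analysis.Analysis"
begin

text \<open>
  The sign \<open>\<nu>\<close> is encoded as the real number 1 or -1, so that \<open>u \<nu>\<close> is the value of
  \<open>u\<close> at the corresponding end point.  The coefficients \<open>\<alpha> \<nu> 0\<close> and \<open>\<beta> \<nu> 0\<close> are those
  on the left-hand side of the boundary condition.  The values of all data for other \<open>\<nu>\<close>, for
  indices above \<open>m \<nu>\<close>, and of \<open>\<eta> \<nu> 0\<close>, are irrelevant.
\<close>

definition mp_boundary_condition ::
  "(real \<Rightarrow> nat) \<Rightarrow> (real \<Rightarrow> nat \<Rightarrow> real) \<Rightarrow> (real \<Rightarrow> nat \<Rightarrow> real) \<Rightarrow> (real \<Rightarrow> nat \<Rightarrow> real)
    \<Rightarrow> real \<Rightarrow> (real \<Rightarrow> real) \<Rightarrow> (real \<Rightarrow> real) \<Rightarrow> bool"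
  where
  "mp_boundary_condition m \<alpha> \<beta> \<eta> \<nu> u u' \<longleftrightarrow>
     \<alpha> \<nu> 0 * u \<nu> + \<beta> \<nu> 0 * u' \<nu> =
       (\<Sum>i=1..m \<nu>. \<alpha> \<nu> i * u (\<eta> \<nu> i)) + (\<Sum>i=1..m \<nu>. \<beta> \<nu> i * u' (\<eta> \<nu> i))"

text \<open>
  Only the restriction of \<open>u\<close> to \<open>[-1,1]\<close> matters.  Derivatives are taken within \<open>[-1,1]\<close>,
  hence are one-sided at the end points, and are uniquely determined there.  The first three
  conjuncts in the scope of the existential quantifier say that \<open>u\<close> belongs to \<open>C\<^sup>2[-1,1]\<close>.
\<close>

definition mp_eigenfunction ::
  "(real \<Rightarrow> nat) \<Rightarrow> (real \<Rightarrow> nat \<Rightarrow> real) \<Rightarrow> (real \<Rightarrow> nat \<Rightarrow> real) \<Rightarrow> (real \<Rightarrow> nat \<Rightarrow> real)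
    \<Rightarrow> real \<Rightarrow> (real \<Rightarrow> real) \<Rightarrow> bool"
  where
  "mp_eigenfunction m \<alpha> \<beta> \<eta> \<mu> u \<longleftrightarrow>
     (\<exists>x\<in>{-1..1}. u x \<noteq> 0) \<and>
     (\<exists>u' u''.
        (\<forall>x\<in>{-1..1}. (u has_real_derivative u' x) (at x within {-1..1})) \<and>
        (\<forall>x\<in>{-1..1}. (u' has_real_derivative u'' x) (at x within {-1..1})) \<and>
        continuous_on {-1..1} u'' \<and>
        (\<forall>x\<in>{-1<..<1}. - u'' x = \<mu> * u x) \<and>
        (\<forall>\<nu>\<in>{-1, 1}. mp_boundary_condition m \<alpha> \<beta> \<eta> \<nu> u u'))"

definition mp_eigenvalue ::
  "(real \<Rightarrow> nat) \<Rightarrow> (real \<Rightarrow> nat \<Rightarrow> real) \<Rightarrow> (real \<Rightarrow> nat \<Rightarrow> real) \<Rightarrow> (real \<Rightarrow> nat \<Rightarrow> real)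
    \<Rightarrow> real \<Rightarrow> bool"
  where
  "mp_eigenvalue m \<alpha> \<beta> \<eta> \<mu> \<longleftrightarrow> (\<exists>u. mp_eigenfunction m \<alpha> \<beta> \<eta> \<mu> u)"

definition mp_principal_eigenvalue ::
  "(real \<Rightarrow> nat) \<Rightarrow> (real \<Rightarrow> nat \<Rightarrow> real) \<Rightarrow> (real \<Rightarrow> nat \<Rightarrow> real) \<Rightarrow> (real \<Rightarrow> nat \<Rightarrow> real)
    \<Rightarrow> real \<Rightarrow> bool"
  where
  "mp_principal_eigenvalue m \<alpha> \<beta> \<eta> \<mu> \<longleftrightarrow>
     mp_eigenvalue m \<alpha> \<beta> \<eta> \<mu> \<and> (\<forall>\<mu>'. mp_eigenvalue m \<alpha> \<beta> \<eta> \<mu>' \<longrightarrow> \<mu> \<le> \<mu>')"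

text \<open>
  Since \<open>x / 0 = 0\<close> in HOL, a fraction with zero denominator is automatically omitted from the
  sum below; the first two conjuncts force the corresponding numerators to vanish.
\<close>

definition mp_small_coefficients ::
  "(real \<Rightarrow> nat) \<Rightarrow> (real \<Rightarrow> nat \<Rightarrow> real) \<Rightarrow> (real \<Rightarrow> nat \<Rightarrow> real) \<Rightarrow> real \<Rightarrow> bool"
  where
  "mp_small_coefficients m \<alpha> \<beta> \<nu> \<longleftrightarrow>
     (\<alpha> \<nu> 0 = 0 \<longrightarrow> (\<Sum>i=1..m \<nu>. \<bar>\<alpha> \<nu> i\<bar>) = 0) \<and>
     (\<beta> \<nu> 0 = 0 \<longrightarrow> (\<Sum>i=1..m \<nu>. \<bar>\<beta> \<nu> i\<bar>) = 0) \<and>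
     ((\<Sum>i=1..m \<nu>. \<bar>\<alpha> \<nu> i\<bar>) / \<alpha> \<nu> 0)\<^sup>2 + ((\<Sum>i=1..m \<nu>. \<bar>\<beta> \<nu> i\<bar>) / \<beta> \<nu> 0)\<^sup>2 < 1"

end

theory Submission
  imports Defs
begin

text \<open>
  Write \<open>\<mu> = s\<^sup>2\<close> for a positive eigenvalue.  An eigenfunction is then a sinusoid
  \<open>C * sin (\<theta> + s * (1 + x))\<close>, and each of the two boundary conditions restricts its phase at the
  corresponding end point.  The proof follows these phases as \<open>s\<close> grows from \<open>0\<close> to \<open>pi/2\<close>,
  where the interval is exactly half a period long.

  At one end point, with phase \<open>\<theta>\<close> there and measuring along the interval away from it, the
  boundary condition is a homogeneous linear equation \<open>P s * sin \<theta> = R s * cos \<theta>\<close>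
  whose coefficients are continuous in \<open>s\<close>.  While \<open>s \<le> pi/2\<close>, every point of the interval is at phase
  distance at most \<open>pi\<close> from the end point.  Nonnegative \<open>\<alpha>\<^sub>i\<close> and small \<open>\<beta>\<^sub>i\<close> then force
  \<open>R s \<ge> 0\<close>, and the point \<open>(P s, R s)\<close> of the plane never meets the closed negative half
  of the first axis.  Its polar angle \<open>\<phi> s\<close> is therefore a continuous function
  with values in \<open>[0, pi)\<close>, and the condition says that \<open>\<theta>\<close> equals \<open>\<phi> s\<close> modulo \<open>pi\<close>
  (\<open>endpoint_phase\<close>).

  Let \<open>\<phi>\<close> and \<open>\<psi>\<close> be the angles of the left and right end points.  Crossing the interval
  advances the phase by \<open>2 * s\<close>, so both conditions can hold for the same sinusoid exactly if
  \<open>H s = \<phi> s + \<psi> s + 2 * s\<close> is a multiple of \<open>pi\<close>.  Unless both \<open>\<alpha>\<^sub>0\<close> vanish, \<open>H\<close> starts below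
  \<open>pi\<close>, because an end point with \<open>\<alpha>\<^sub>0 \<noteq> 0\<close> contributes \<open>0\<close> and the other one at most
  \<open>pi/2\<close>; and \<open>H (pi/2) \<ge> pi\<close>.  At the first \<open>s\<close> with \<open>H s = pi\<close> the phase runs
  through \<open>[\<phi> s, pi - \<psi> s]\<close>, a part of \<open>[0, pi]\<close>, so that the eigenfunction is positive inside; and
  \<open>\<beta>\<^sub>0 \<noteq> 0\<close> makes the angle of its end point positive, hence the eigenfunction positive there.  For smaller
  positive \<open>s\<close> the value \<open>H s\<close> lies strictly between \<open>0\<close> and \<open>pi\<close>, so there is no
  smaller positive eigenvalue.

  Negative eigenvalues do not exist, and \<open>0\<close> is an eigenvalue only if both \<open>\<alpha>\<^sub>0\<close> vanish, with
  constant eigenfunctions (\<open>nonpositive_eigenvalue_constant\<close>).  In that remaining case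
  \<open>0\<close> is the principal eigenvalue.
\<close>

section \<open>Phases forced by a boundary condition\<close>

text \<open>
  The boundary condition at one end point for the function \<open>sin (\<theta> + s * t)\<close> of the distance \<open>t\<close>
  to that end point; \<open>\<delta> i\<close> is the distance of the \<open>i\<close>-th node on the right-hand side.  The derivative
  terms refer to the outward derivative, which explains the minus signs and makes
  \<open>b\<^sub>0\<close> nonnegative at either end.
\<close>

definition endpoint_condition ::
  "'i set \<Rightarrow> real \<Rightarrow> real \<Rightarrow> ('i \<Rightarrow> real) \<Rightarrow> ('i \<Rightarrow> real) \<Rightarrow> ('i \<Rightarrow> real) \<Rightarrow> real \<Rightarrow> real \<Rightarrow> bool"
  where
  "endpoint_condition I a\<^sub>0 b\<^sub>0 a b \<delta> s \<theta> \<longleftrightarrow>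
     a\<^sub>0 * sin \<theta> - s * b\<^sub>0 * cos \<theta> =
       (\<Sum>i\<in>I. a i * sin (\<theta> + s * \<delta> i)) - s * (\<Sum>i\<in>I. b i * cos (\<theta> + s * \<delta> i))"

text \<open>
  The coefficients on one side of a boundary condition are outweighed by the one on the other side.
  If \<open>c = 0\<close>, strict inequality is impossible and the coefficients vanish instead.
\<close>

definition dominates :: "real \<Rightarrow> 'i set \<Rightarrow> ('i \<Rightarrow> real) \<Rightarrow> bool"
  where "dominates c I f \<longleftrightarrow> (if c = 0 then (\<forall>i\<in>I. f i = 0) else (\<Sum>i\<in>I. \<bar>f i\<bar>) < c)"

lemma dominates_sum_le:
  assumes "dominates c I f" "0 \<le> c" "\<And>i. i \<in> I \<Longrightarrow> \<bar>g i\<bar> \<le> 1"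
  shows "\<bar>\<Sum>i\<in>I. f i * g i\<bar> \<le> c" and "c \<noteq> 0 \<Longrightarrow> \<bar>\<Sum>i\<in>I. f i * g i\<bar> < c"
proof -
  have "\<bar>\<Sum>i\<in>I. f i * g i\<bar> \<le> (\<Sum>i\<in>I. \<bar>f i\<bar>)"
    using assms(3) by (intro order_trans[OF sum_abs] sum_mono) (simp add: abs_mult mult_left_le)
  with assms(1,2) show "\<bar>\<Sum>i\<in>I. f i * g i\<bar> \<le> c" "c \<noteq> 0 \<Longrightarrow> \<bar>\<Sum>i\<in>I. f i * g i\<bar> < c"
    by (auto simp: dominates_def split: if_splits)
qed

text \<open>
  By the addition theorems the condition becomes \<open>P s * sin \<theta> = R s * cos \<theta>\<close>, where
  \<open>R s \<ge> 0\<close> because \<open>s * \<delta> i\<close> lies in \<open>[0, pi]\<close>, and \<open>R s = 0\<close> only where \<open>P s > 0\<close>.  So the polar angle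
  \<open>\<phi> s\<close> of \<open>(P s, R s)\<close> is continuous.  The values at \<open>s = 0\<close>, where no boundary condition is
  involved, are the limits from which the phase starts: \<open>0\<close> when \<open>a\<^sub>0\<close> is present, and otherwise
  at most \<open>pi/2\<close>.
\<close>

lemma endpoint_phase:
  fixes a\<^sub>0 b\<^sub>0 :: real and a b \<delta> :: "'i \<Rightarrow> real"
  assumes "0 \<le> a\<^sub>0" "0 \<le> b\<^sub>0" "0 < a\<^sub>0 + b\<^sub>0"
    and doma: "dominates a\<^sub>0 I a" and domb: "dominates b\<^sub>0 I b"
    and a_nonneg: "\<And>i. i \<in> I \<Longrightarrow> 0 \<le> a i"
    and delta: "\<And>i. i \<in> I \<Longrightarrow> \<delta> i \<in> {0..2}"
  obtains \<phi> where "continuous_on {0..pi/2} \<phi>"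
    and "\<And>s. s \<in> {0..pi/2} \<Longrightarrow> 0 \<le> \<phi> s \<and> \<phi> s < pi"
    and "\<phi> 0 \<le> pi/2" and "a\<^sub>0 \<noteq> 0 \<Longrightarrow> \<phi> 0 = 0"
    and "\<And>s. b\<^sub>0 \<noteq> 0 \<Longrightarrow> s \<in> {0<..pi/2} \<Longrightarrow> 0 < \<phi> s"
    and "\<And>s \<theta>. s \<in> {0<..pi/2} \<Longrightarrow>
           endpoint_condition I a\<^sub>0 b\<^sub>0 a b \<delta> s \<theta> \<longleftrightarrow> sin (\<theta> - \<phi> s) = 0"
proof -
  \<comment> \<open>If \<open>a\<^sub>0 = 0\<close>, both coefficients are multiples of \<open>s\<close> and would vanish at \<open>s = 0\<close>, where the angle
    is then undefined.  Replacing the factor \<open>s\<close> by \<open>1\<close> divides them by \<open>s\<close>, which leaves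
    the angle unchanged for positive \<open>s\<close>.\<close>
  define k :: "real \<Rightarrow> real" where "k s = (if a\<^sub>0 = 0 then 1 else s)" for s
  define P where "P s = a\<^sub>0 - (\<Sum>i\<in>I. a i * cos (s * \<delta> i)) - k s * (\<Sum>i\<in>I. b i * sin (s * \<delta> i))" for s
  define R where "R s = k s * (b\<^sub>0 - (\<Sum>i\<in>I. b i * cos (s * \<delta> i))) + (\<Sum>i\<in>I. a i * sin (s * \<delta> i))" for s
  define \<phi> where "\<phi> s = Arg (Complex (P s) (R s))" for s
  have k: "0 \<le> k s" if "0 \<le> s" for s using that by (simp add: k_def)
  have b_pos: "0 < b\<^sub>0 - (\<Sum>i\<in>I. b i * cos (s * \<delta> i))" if "b\<^sub>0 \<noteq> 0" for s
    using dominates_sum_le(2)[OF domb \<open>0 \<le> b\<^sub>0\<close>, of "\<lambda>i. cos (s * \<delta> i)"] that by auto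
  have b_nonneg: "0 \<le> b\<^sub>0 - (\<Sum>i\<in>I. b i * cos (s * \<delta> i))" for s
    using dominates_sum_le(1)[OF domb \<open>0 \<le> b\<^sub>0\<close>, of "\<lambda>i. cos (s * \<delta> i)"] by auto
  have a_sin: "0 \<le> (\<Sum>i\<in>I. a i * sin (s * \<delta> i))" if "s \<in> {0..pi/2}" for s
  proof (rule sum_nonneg)
    fix i assume i: "i \<in> I"
    then have d: "0 \<le> \<delta> i" "\<delta> i \<le> 2" using delta by auto
    have "s * \<delta> i \<le> (pi/2) * 2" using d that by (intro mult_mono) auto
    then have "0 \<le> sin (s * \<delta> i)" using d that by (intro sin_ge_zero) auto
    then show "0 \<le> a i * sin (s * \<delta> i)" using a_nonneg[OF i] by simp
  qed
  have R_nonneg: "0 \<le> R s" if "s \<in> {0..pi/2}" for s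
    unfolding R_def using that k b_nonneg a_sin by (intro add_nonneg_nonneg mult_nonneg_nonneg) auto
  have R_pos: "0 < R s" if "s \<in> {0..pi/2}" "b\<^sub>0 \<noteq> 0" "k s \<noteq> 0" for s
    unfolding R_def using that k[of s] b_pos a_sin
    by (intro add_pos_nonneg mult_pos_pos) auto
  have P_pos: "0 < P s" if "b\<^sub>0 = 0 \<or> k s = 0" for s
  proof -
    have "a\<^sub>0 \<noteq> 0" using that assms(3) by (auto simp: k_def split: if_splits)
    moreover have "k s * (\<Sum>i\<in>I. b i * sin (s * \<delta> i)) = 0"
      using that domb by (auto simp: dominates_def)
    ultimately show ?thesis
      using dominates_sum_le(2)[OF doma \<open>0 \<le> a\<^sub>0\<close>, of "\<lambda>i. cos (s * \<delta> i)"]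
      by (auto simp: P_def)
  qed
  have nonpos: "Complex (P s) (R s) \<notin> \<real>\<^sub>\<le>\<^sub>0" if "s \<in> {0..pi/2}" for s
    using R_pos[OF that] P_pos[of s] by (fastforce simp: complex_nonpos_Reals_iff)
  have cont: "continuous_on {0..pi/2} \<phi>"
    unfolding \<phi>_def
  proof (rule continuous_on_Arg'[OF _ nonpos])
    have "continuous_on {0..pi/2} k" by (cases "a\<^sub>0 = 0") (simp_all add: k_def)
    then show "continuous_on {0..pi/2} (\<lambda>s. Complex (P s) (R s))"
      unfolding P_def R_def Complex_eq by (intro continuous_intros)
  qed
  have range: "0 \<le> \<phi> s \<and> \<phi> s < pi" if "s \<in> {0..pi/2}" for s
  proof -
    have "\<phi> s \<noteq> pi" using nonpos[OF that] by (auto simp: \<phi>_def Arg_eq_pi complex_nonpos_Reals_iff)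
    moreover have "0 \<le> \<phi> s" using R_nonneg[OF that] by (simp add: \<phi>_def Arg_less_0)
    ultimately show ?thesis using Arg_le_pi[of "Complex (P s) (R s)"] by (simp add: \<phi>_def)
  qed
  have z1: "\<phi> 0 = 0" if "a\<^sub>0 \<noteq> 0"
    using that P_pos[of 0]
    by (simp add: \<phi>_def Arg_eq_0 complex_is_Real_iff R_def k_def)
  have z2: "\<phi> 0 \<le> pi/2"
  proof (cases "a\<^sub>0 = 0")
    case True
    then have "P 0 = 0" using doma by (simp add: P_def dominates_def)
    then have "\<bar>\<phi> 0\<bar> \<le> pi/2" unfolding \<phi>_def Arg_Re_nonneg by simp
    then show ?thesis by simp
  qed (simp add: z1)
  have pos: "0 < \<phi> s" if "b\<^sub>0 \<noteq> 0" "s \<in> {0<..pi/2}" for s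
    using R_pos[of s] that by (auto simp: \<phi>_def Arg_pos_iff k_def)
  have cond: "endpoint_condition I a\<^sub>0 b\<^sub>0 a b \<delta> s \<theta> \<longleftrightarrow> sin (\<theta> - \<phi> s) = 0"
    if "s \<in> {0<..pi/2}" for s \<theta>
  proof -
    \<comment> \<open>The factor by which \<open>P\<close> and \<open>R\<close> were divided.\<close>
    define w where "w = (if a\<^sub>0 = 0 then s else 1)"
    define r where "r = cmod (Complex (P s) (R s))"
    have w: "w \<noteq> 0" "w * k s = s" using that by (auto simp: w_def k_def)
    have wa0: "w * a\<^sub>0 = a\<^sub>0" by (simp add: w_def)
    have wa: "w * (\<Sum>i\<in>I. a i * g i) = (\<Sum>i\<in>I. a i * g i)" for g
      using doma by (auto simp: w_def dominates_def)
    have r: "r \<noteq> 0" using nonpos[of s] that by (auto simp: r_def)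
    have "rcis r (\<phi> s) = Complex (P s) (R s)"
      unfolding r_def \<phi>_def by (rule rcis_cmod_Arg)
    then have PR: "P s = r * cos (\<phi> s)" "R s = r * sin (\<phi> s)"
      by (simp_all add: complex_eq_iff)
    have wP: "w * P s = a\<^sub>0 - (\<Sum>i\<in>I. a i * cos (s * \<delta> i)) - s * (\<Sum>i\<in>I. b i * sin (s * \<delta> i))"
      unfolding P_def using w(2) by (simp add: right_diff_distrib wa wa0 flip: mult.assoc)
    have wR: "w * R s = s * (b\<^sub>0 - (\<Sum>i\<in>I. b i * cos (s * \<delta> i))) + (\<Sum>i\<in>I. a i * sin (s * \<delta> i))"
      unfolding R_def using w(2) by (simp add: distrib_left wa flip: mult.assoc)
    have "a\<^sub>0 * sin \<theta> - s * b\<^sub>0 * cos \<theta>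
        - ((\<Sum>i\<in>I. a i * sin (\<theta> + s * \<delta> i)) - s * (\<Sum>i\<in>I. b i * cos (\<theta> + s * \<delta> i)))
        = (w * P s) * sin \<theta> - (w * R s) * cos \<theta>"
      unfolding wP wR
      by (simp add: sin_add cos_add algebra_simps sum.distrib sum_subtractf sum_distrib_left)
    also have "\<dots> = w * r * sin (\<theta> - \<phi> s)"
      unfolding PR by (simp add: sin_diff algebra_simps)
    finally have "a\<^sub>0 * sin \<theta> - s * b\<^sub>0 * cos \<theta>
        - ((\<Sum>i\<in>I. a i * sin (\<theta> + s * \<delta> i)) - s * (\<Sum>i\<in>I. b i * cos (\<theta> + s * \<delta> i)))
        = w * r * sin (\<theta> - \<phi> s)" .
    then show ?thesis using w(1) r
      unfolding endpoint_condition_def by (subst eq_iff_diff_eq_0) simp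
  qed
  show thesis by (rule that[OF cont range z2 z1 pos cond])
qed

section \<open>Solutions of the differential equation\<close>

text \<open>
  Continuity of the second derivative extends the differential equation to the end points, so that it
  can be used on the whole closed interval.
\<close>

lemma mp_eigenfunction_derivative:
  assumes "mp_eigenfunction m \<alpha> \<beta> \<eta> \<mu> u"
  shows "\<exists>u'. (\<exists>x\<in>{-1..1}. u x \<noteq> 0) \<and>
    (\<forall>x\<in>{-1..1}. (u has_real_derivative u' x) (at x within {-1..1})) \<and>
    (\<forall>x\<in>{-1..1}. (u' has_real_derivative - \<mu> * u x) (at x within {-1..1})) \<and>
    (\<forall>\<nu>\<in>{-1, 1}. mp_boundary_condition m \<alpha> \<beta> \<eta> \<nu> u u')"
proof -
  obtain u' u'' where u': "\<forall>x\<in>{-1..1}. (u has_real_derivative u' x) (at x within {-1..1})"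
    and u'': "\<forall>x\<in>{-1..1}. (u' has_real_derivative u'' x) (at x within {-1..1})"
    and cont: "continuous_on {-1..1} u''"
    and ode: "\<forall>x\<in>{-1<..<1}. - u'' x = \<mu> * u x"
    and bc: "\<forall>\<nu>\<in>{-1, 1}. mp_boundary_condition m \<alpha> \<beta> \<eta> \<nu> u u'"
    using assms unfolding mp_eigenfunction_def by blast
  have "continuous_on {-1..1} u" using u' DERIV_continuous_on by blast
  then have "continuous_on (closure {-1<..<1}) (\<lambda>x. u'' x + \<mu> * u x)"
    using cont by (simp add: continuous_intros)
  then have "u'' x + \<mu> * u x = 0" if "x \<in> {-1..1}" for x
    using continuous_constant_on_closure[of "{-1<..<1}" "\<lambda>x. u'' x + \<mu> * u x" 0 x] ode that
    by force
  then have eq: "u'' x = - \<mu> * u x" if "x \<in> {-1..1}" for x using that by (smt (verit) mult_minus_left)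
  have "(u' has_real_derivative - \<mu> * u x) (at x within {-1..1})" if "x \<in> {-1..1}" for x
    using u'' eq[OF that] that by metis
  moreover have "\<exists>x\<in>{-1..1}. u x \<noteq> 0" using assms by (simp add: mp_eigenfunction_def)
  ultimately show ?thesis using u' bc by (intro exI[of _ u']) auto
qed

text \<open>
  Rotating the vector \<open>(s * u x, u' x)\<close> back by the angle \<open>s * (1 + x)\<close> gives a vector \<open>(f x, g x)\<close> with
  zero derivative.  The polar form of this constant vector yields the amplitude and the phase.
\<close>

lemma harmonic_oscillator_solution:
  fixes u u' :: "real \<Rightarrow> real"
  assumes s: "s \<noteq> 0"
    and u: "\<And>x. x \<in> {-1..1} \<Longrightarrow> (u has_real_derivative u' x) (at x within {-1..1})"
    and u': "\<And>x. x \<in> {-1..1} \<Longrightarrow> (u' has_real_derivative - s\<^sup>2 * u x) (at x within {-1..1})"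
  obtains C \<theta> where "\<forall>x\<in>{-1..1}. u x = C * sin (\<theta> + s * (1 + x))"
    and "\<forall>x\<in>{-1..1}. u' x = s * C * cos (\<theta> + s * (1 + x))"
proof -
  define f where "f x = s * u x * cos (s * (1 + x)) - u' x * sin (s * (1 + x))" for x
  define g where "g x = s * u x * sin (s * (1 + x)) + u' x * cos (s * (1 + x))" for x
  have "(f has_real_derivative 0) (at x within {-1..1})" if "x \<in> {-1..1}" for x
    unfolding f_def using that
    by (auto intro!: derivative_eq_intros u u' simp: algebra_simps power2_eq_square)
  then obtain c where c: "\<And>x. x \<in> {-1..1} \<Longrightarrow> f x = c"
    using has_field_derivative_zero_constant[of "{-1..1}" f] by auto
  have "(g has_real_derivative 0) (at x within {-1..1})" if "x \<in> {-1..1}" for x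
    unfolding g_def using that
    by (auto intro!: derivative_eq_intros u u' simp: algebra_simps power2_eq_square)
  then obtain d where d: "\<And>x. x \<in> {-1..1} \<Longrightarrow> g x = d"
    using has_field_derivative_zero_constant[of "{-1..1}" g] by auto
  obtain r \<theta> where r: "d = r * cos \<theta>" "c = r * sin \<theta>" using polar_Ex by blast
  have rot: "X = A * cos t + B * sin t \<and> Y = B * cos t - A * sin t"
    if "X * cos t - Y * sin t = A" "X * sin t + Y * cos t = B" for X Y A B t :: real
  proof -
    have "A * cos t + B * sin t = X * (cos t * cos t) + X * (sin t * sin t)"
      "B * cos t - A * sin t = Y * (cos t * cos t) + Y * (sin t * sin t)"
      unfolding that[symmetric] by (simp_all add: algebra_simps)
    then show ?thesis by (simp flip: distrib_left)
  qed
  have *: "s * u x = r * sin (\<theta> + s * (1 + x)) \<and> u' x = r * cos (\<theta> + s * (1 + x))"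
    if "x \<in> {-1..1}" for x
    using rot[OF c[OF that, unfolded f_def] d[OF that, unfolded g_def]]
    by (simp add: r sin_add cos_add algebra_simps)
  show thesis
  proof
    show "\<forall>x\<in>{-1..1}. u x = (r / s) * sin (\<theta> + s * (1 + x))"
      using * s by (simp add: field_simps)
    show "\<forall>x\<in>{-1..1}. u' x = s * (r / s) * cos (\<theta> + s * (1 + x))"
      using * s by simp
  qed
qed

lemma boundary_condition_sine:
  assumes nu: "\<nu> \<in> {-1, 1}" and C: "C \<noteq> 0"
    and eta: "\<And>i. i \<in> {1..m \<nu>} \<Longrightarrow> \<eta> \<nu> i \<in> {-1..1}"
    and u: "\<And>x. x \<in> {-1..1} \<Longrightarrow> u x = C * sin (\<theta> + s * (1 - \<nu> * x))"
    and u': "\<And>x. x \<in> {-1..1} \<Longrightarrow> u' x = - \<nu> * s * C * cos (\<theta> + s * (1 - \<nu> * x))"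
  shows "mp_boundary_condition m \<alpha> \<beta> \<eta> \<nu> u u' \<longleftrightarrow>
    endpoint_condition {1..m \<nu>} (\<alpha> \<nu> 0) (\<nu> * \<beta> \<nu> 0) (\<alpha> \<nu>) (\<lambda>i. \<nu> * \<beta> \<nu> i) (\<lambda>i. 1 - \<nu> * \<eta> \<nu> i) s \<theta>"
proof -
  have nu2: "\<nu> * \<nu> = 1" "\<nu> \<in> {-1..1}" using nu by auto
  have "\<alpha> \<nu> 0 * u \<nu> + \<beta> \<nu> 0 * u' \<nu> = C * (\<alpha> \<nu> 0 * sin \<theta> - s * (\<nu> * \<beta> \<nu> 0) * cos \<theta>)"
    using u[OF nu2(2)] u'[OF nu2(2)] nu2(1) by (simp add: algebra_simps)
  moreover have "(\<Sum>i=1..m \<nu>. \<alpha> \<nu> i * u (\<eta> \<nu> i)) + (\<Sum>i=1..m \<nu>. \<beta> \<nu> i * u' (\<eta> \<nu> i)) =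
      C * ((\<Sum>i\<in>{1..m \<nu>}. \<alpha> \<nu> i * sin (\<theta> + s * (1 - \<nu> * \<eta> \<nu> i)))
        - s * (\<Sum>i\<in>{1..m \<nu>}. \<nu> * \<beta> \<nu> i * cos (\<theta> + s * (1 - \<nu> * \<eta> \<nu> i))))"
    using u[OF eta] u'[OF eta]
    by (simp add: right_diff_distrib sum_distrib_left sum_negf mult_ac cong: sum.cong_simp)
  ultimately show ?thesis
    using C by (simp add: mp_boundary_condition_def endpoint_condition_def)
qed

section \<open>Nonpositive eigenvalues\<close>

text \<open>
  A convex function attains its maximum at an end point, and there it does not decrease towards the
  outside.
\<close>

lemma max_at_endpoint_of_convex:
  fixes g g' :: "real \<Rightarrow> real"
  assumes g: "\<And>x. x \<in> {-1..1} \<Longrightarrow> (g has_real_derivative g' x) (at x within {-1..1})"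
    and mono: "mono_on {-1..1} g'"
  obtains \<nu> where "\<nu> \<in> {-1, 1}" "\<And>x. x \<in> {-1..1} \<Longrightarrow> g x \<le> g \<nu>" "0 \<le> \<nu> * g' \<nu>"
proof -
  have mvt: "\<exists>\<xi>\<in>{x<..<y}. g y - g x = g' \<xi> * (y - x)" if "-1 \<le> x" "x < y" "y \<le> 1" for x y
    using that
    by (intro mvt_simple[where f'="\<lambda>x h. g' x * h"])
       (auto intro!: DERIV_subset[OF g, unfolded has_field_derivative_def])
  have le: "g' x \<le> g' y" if "-1 \<le> x" "x \<le> y" "y \<le> 1" for x y
    using mono_onD[OF mono, of x y] that by auto
  have "g x \<le> max (g (-1)) (g 1)" if x: "x \<in> {-1..1}" for x
  proof (cases "x = -1 \<or> x = 1")
    case False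
    then have x': "-1 < x" "x < 1" using x by auto
    obtain y where y: "y \<in> {-1<..<x}" "g x - g (-1) = g' y * (x + 1)"
      using mvt[of "-1" x] x' by auto
    obtain z where z: "z \<in> {x<..<1}" "g 1 - g x = g' z * (1 - x)"
      using mvt[of x 1] x' by auto
    show ?thesis
    proof (cases "0 \<le> g' x")
      case True
      then have "0 \<le> g' z" using le[of x z] z x' by auto
      then have "0 \<le> g 1 - g x" using z x' by simp
      then show ?thesis by simp
    next
      case False
      then have "g' y \<le> 0" using le[of y x] y x' by auto
      then have "g x - g (-1) \<le> 0" unfolding y(2) using x' by (intro mult_nonpos_nonneg) auto
      then show ?thesis by simp
    qed
  qed auto
  moreover obtain \<xi> where \<xi>: "-1 < \<xi>" "\<xi> < 1" "g 1 - g (-1) = g' \<xi> * 2" using mvt[of "-1" 1] by auto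
  moreover have "g' (-1) \<le> g' \<xi>" "g' \<xi> \<le> g' 1" using le \<xi> by auto
  ultimately show thesis
    using that[of 1] that[of "-1"] by (cases "g (-1) \<le> g 1") (force simp: max_def)+
qed

text \<open>
  For \<open>\<mu> \<le> 0\<close> the function \<open>u\<^sup>2\<close> is convex, hence \<open>\<bar>u\<bar>\<close> is largest at an end point \<open>\<nu>\<close>, where \<open>u\<close> and
  its outward derivative do not have opposite signs.  Since \<open>u'\<^sup>2 + \<mu> * u\<^sup>2\<close> is constant, \<open>\<bar>u'\<bar>\<close> is
  largest at \<open>\<nu>\<close> too.  The two terms on the left of the boundary condition at \<open>\<nu>\<close> thus add up without
  cancellation, and the terms on the right cannot match them unless \<open>\<alpha>\<^sub>0\<close> and \<open>u' \<nu>\<close> vanish, which makes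
  \<open>u\<close> constant.  A nonzero constant in turn violates any boundary condition with \<open>\<alpha>\<^sub>0 > 0\<close>.
\<close>

lemma nonpositive_eigenvalue_constant:
  assumes eta: "\<forall>\<nu>\<in>{-1, 1}. \<forall>i\<in>{1..m \<nu>}. \<eta> \<nu> i \<in> {-1..1}"
    and alpha0: "\<forall>\<nu>\<in>{-1, 1}. \<alpha> \<nu> 0 \<ge> 0"
    and nontrivial: "\<forall>\<nu>\<in>{-1, 1}. \<alpha> \<nu> 0 + \<bar>\<beta> \<nu> 0\<bar> > 0"
    and beta0: "\<forall>\<nu>\<in>{-1, 1}. \<nu> * \<beta> \<nu> 0 \<ge> 0"
    and doma: "\<forall>\<nu>\<in>{-1, 1}. dominates (\<alpha> \<nu> 0) {1..m \<nu>} (\<alpha> \<nu>)"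
    and domb: "\<forall>\<nu>\<in>{-1, 1}. dominates (\<nu> * \<beta> \<nu> 0) {1..m \<nu>} (\<lambda>i. \<nu> * \<beta> \<nu> i)"
    and eig: "mp_eigenfunction m \<alpha> \<beta> \<eta> \<mu> u" and "\<mu> \<le> 0"
  shows "\<mu> = 0 \<and> \<alpha> (-1) 0 = 0 \<and> \<alpha> 1 0 = 0 \<and> (\<exists>c. c \<noteq> 0 \<and> (\<forall>x\<in>{-1..1}. u x = c))"
proof -
  obtain u' where nz: "\<exists>x\<in>{-1..1}. u x \<noteq> 0"
    and der: "\<forall>x\<in>{-1..1}. (u has_real_derivative u' x) (at x within {-1..1})"
      "\<forall>x\<in>{-1..1}. (u' has_real_derivative - \<mu> * u x) (at x within {-1..1})"
    and bc: "\<forall>\<nu>\<in>{-1, 1}. mp_boundary_condition m \<alpha> \<beta> \<eta> \<nu> u u'"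
    using mp_eigenfunction_derivative[OF eig] by blast
  note u = bspec[OF der(1)] and u' = bspec[OF der(2)]
  have "mono_on {-1..1} (\<lambda>x. 2 * u x * u' x)"
  proof (rule mono_onI)
    fix x y :: real assume xy: "x \<in> {-1..1}" "y \<in> {-1..1}" "x \<le> y"
    show "2 * u x * u' x \<le> 2 * u y * u' y"
    proof (cases "x = y")
      case False
      then have "\<exists>\<xi>\<in>{x<..<y}. 2 * u y * u' y - 2 * u x * u' x
          = (2 * ((u' \<xi>)\<^sup>2 - \<mu> * (u \<xi>)\<^sup>2)) * (y - x)"
      proof (intro mvt_simple[where f'="\<lambda>\<xi> h. (2 * ((u' \<xi>)\<^sup>2 - \<mu> * (u \<xi>)\<^sup>2)) * h"])
        fix z assume z: "x \<le> z" "z \<le> y"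
        have "((\<lambda>x. 2 * u x * u' x) has_real_derivative 2 * ((u' z)\<^sup>2 - \<mu> * (u z)\<^sup>2))
            (at z within {-1..1})"
          using xy z by (auto intro!: derivative_eq_intros u u' simp: algebra_simps power2_eq_square)
        then have "((\<lambda>x. 2 * u x * u' x) has_real_derivative 2 * ((u' z)\<^sup>2 - \<mu> * (u z)\<^sup>2))
            (at z within {x..y})"
          by (rule DERIV_subset) (use xy in auto)
        then show "((\<lambda>x. 2 * u x * u' x) has_derivative
            (\<lambda>h. (2 * ((u' z)\<^sup>2 - \<mu> * (u z)\<^sup>2)) * h)) (at z within {x..y})"
          by (simp add: has_field_derivative_def)
      qed (use xy in simp)
      moreover have "0 \<le> (u' \<xi>)\<^sup>2 - \<mu> * (u \<xi>)\<^sup>2" for \<xi>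
        using \<open>\<mu> \<le> 0\<close> by (simp add: mult_nonpos_nonneg order_trans[of _ 0])
      ultimately show ?thesis using xy
        by (smt (verit) mult_nonneg_nonneg)
    qed simp
  qed
  moreover have "((\<lambda>x. (u x)\<^sup>2) has_real_derivative 2 * u x * u' x) (at x within {-1..1})"
    if "x \<in> {-1..1}" for x
    using that by (auto intro!: derivative_eq_intros u)
  ultimately obtain \<nu> where nu: "\<nu> \<in> {-1, 1}"
    and max: "\<And>x. x \<in> {-1..1} \<Longrightarrow> (u x)\<^sup>2 \<le> (u \<nu>)\<^sup>2" and sgn: "0 \<le> \<nu> * (2 * u \<nu> * u' \<nu>)"
    using max_at_endpoint_of_convex[of "\<lambda>x. (u x)\<^sup>2" "\<lambda>x. 2 * u x * u' x"] by blast
  have nu': "\<nu> \<in> {-1..1}" "\<nu> * \<nu> = 1" "\<bar>\<nu>\<bar> = 1" using nu by auto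
  have "\<exists>K. \<forall>x\<in>{-1..1}. (u' x)\<^sup>2 + \<mu> * (u x)\<^sup>2 = K"
    by (rule has_field_derivative_zero_constant)
       (auto intro!: derivative_eq_intros u u' simp: algebra_simps)
  then obtain K where K: "\<And>x. x \<in> {-1..1} \<Longrightarrow> (u' x)\<^sup>2 + \<mu> * (u x)\<^sup>2 = K" by blast
  have max': "(u' x)\<^sup>2 \<le> (u' \<nu>)\<^sup>2" if "x \<in> {-1..1}" for x
    using K[OF that] K[OF nu'(1)] mult_left_mono_neg[OF max[OF that] \<open>\<mu> \<le> 0\<close>] by simp
  have absu: "\<bar>u x\<bar> \<le> \<bar>u \<nu>\<bar>" "\<bar>u' x\<bar> \<le> \<bar>u' \<nu>\<bar>" if "x \<in> {-1..1}" for x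
    using max[OF that] max'[OF that] by (simp_all add: abs_le_square_iff)
  define a b where "a = \<alpha> \<nu> 0" and "b = \<nu> * \<beta> \<nu> 0"
  have ab: "0 \<le> a" "0 \<le> b" "0 < a + b"
    using alpha0 beta0 nontrivial nu by (auto simp: a_def b_def)
  have lhs: "\<bar>\<alpha> \<nu> 0 * u \<nu> + \<beta> \<nu> 0 * u' \<nu>\<bar> = a * \<bar>u \<nu>\<bar> + b * \<bar>u' \<nu>\<bar>"
  proof -
    have eq: "\<beta> \<nu> 0 * u' \<nu> = b * (\<nu> * u' \<nu>)" using nu by (auto simp: b_def)
    have "0 \<le> u \<nu> * (\<nu> * u' \<nu>)" using sgn by (simp add: algebra_simps)
    then have "\<bar>a * u \<nu> + b * (\<nu> * u' \<nu>)\<bar> = \<bar>a * u \<nu>\<bar> + \<bar>b * (\<nu> * u' \<nu>)\<bar>"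
      using ab by (smt (verit, best) mult_nonneg_nonneg mult_nonneg_nonpos zero_le_mult_iff)
    then show ?thesis unfolding eq a_def[symmetric] using ab nu' by (simp add: abs_mult)
  qed
  have sum_bound: "\<exists>q. q \<le> c \<and> (c \<noteq> 0 \<longrightarrow> q < c) \<and> \<bar>\<Sum>i\<in>{1..m \<nu>}. f i * v (\<eta> \<nu> i)\<bar> \<le> q * M"
    if "dominates c {1..m \<nu>} f" "0 \<le> c" "\<And>x. x \<in> {-1..1} \<Longrightarrow> \<bar>v x\<bar> \<le> M" for c f M and v :: "real \<Rightarrow> real"
  proof (intro exI conjI)
    have "\<bar>\<Sum>i\<in>{1..m \<nu>}. f i * v (\<eta> \<nu> i)\<bar> \<le> (\<Sum>i\<in>{1..m \<nu>}. \<bar>f i\<bar> * M)"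
      using that(3) eta nu
      by (intro order_trans[OF sum_abs] sum_mono) (auto simp: abs_mult intro!: mult_left_mono)
    then show "\<bar>\<Sum>i\<in>{1..m \<nu>}. f i * v (\<eta> \<nu> i)\<bar> \<le> (\<Sum>i\<in>{1..m \<nu>}. \<bar>f i\<bar>) * M"
      by (simp add: sum_distrib_right)
  qed (use that in \<open>auto simp: dominates_def split: if_splits\<close>)
  have dom: "dominates a {1..m \<nu>} (\<alpha> \<nu>)" "dominates b {1..m \<nu>} (\<lambda>i. \<nu> * \<beta> \<nu> i)"
    unfolding a_def b_def using doma domb nu by blast+
  obtain q where q: "q \<le> a" "a \<noteq> 0 \<longrightarrow> q < a"
      "\<bar>\<Sum>i\<in>{1..m \<nu>}. \<alpha> \<nu> i * u (\<eta> \<nu> i)\<bar> \<le> q * \<bar>u \<nu>\<bar>"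
    using sum_bound[where v=u, OF dom(1) ab(1) absu(1)] by blast
  obtain p where p: "p \<le> b" "b \<noteq> 0 \<longrightarrow> p < b"
      "\<bar>\<Sum>i\<in>{1..m \<nu>}. \<nu> * \<beta> \<nu> i * u' (\<eta> \<nu> i)\<bar> \<le> p * \<bar>u' \<nu>\<bar>"
    using sum_bound[where v="u'", OF dom(2) ab(2) absu(2)] by blast
  have "\<bar>\<Sum>i\<in>{1..m \<nu>}. \<nu> * \<beta> \<nu> i * u' (\<eta> \<nu> i)\<bar> = \<bar>\<Sum>i\<in>{1..m \<nu>}. \<beta> \<nu> i * u' (\<eta> \<nu> i)\<bar>"
    using nu by (auto simp: sum_negf)
  then have "a * \<bar>u \<nu>\<bar> + b * \<bar>u' \<nu>\<bar> \<le> q * \<bar>u \<nu>\<bar> + p * \<bar>u' \<nu>\<bar>"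
    using bspec[OF bc nu] p(3) q(3) unfolding lhs[symmetric] mp_boundary_condition_def by linarith
  moreover have "q * \<bar>u \<nu>\<bar> \<le> a * \<bar>u \<nu>\<bar>" "p * \<bar>u' \<nu>\<bar> \<le> b * \<bar>u' \<nu>\<bar>"
    using p q by (auto intro: mult_right_mono)
  ultimately have "(a - q) * \<bar>u \<nu>\<bar> = 0" "(b - p) * \<bar>u' \<nu>\<bar> = 0"
    unfolding left_diff_distrib by linarith+
  then have z: "a \<noteq> 0 \<longrightarrow> u \<nu> = 0" "b \<noteq> 0 \<longrightarrow> u' \<nu> = 0" using p q by auto
  have "u \<nu> \<noteq> 0" using nz absu(1) by force
  then have "a = 0" "u' \<nu> = 0" using z ab by auto
  then have u'0: "u' x = 0" if "x \<in> {-1..1}" for x using absu(2)[OF that] by simp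
  then have "\<exists>c. \<forall>x\<in>{-1..1}. u x = c"
    using u by (intro has_field_derivative_zero_constant) auto
  then obtain c where c: "\<And>x. x \<in> {-1..1} \<Longrightarrow> u x = c" by blast
  have c0: "c \<noteq> 0" using nz c by auto
  have "\<mu> = 0"
  proof -
    have "\<exists>x\<in>{-1<..<1}. u' 1 - u' (-1) = (- \<mu> * u x) * (1 - (-1))"
      using der(2) by (intro mvt_simple[where f'="\<lambda>x. (*) (- \<mu> * u x)"])
        (auto simp: has_field_derivative_def)
    then show ?thesis using u'0 c c0 by auto
  qed
  moreover have "\<alpha> \<sigma> 0 = 0" if s: "\<sigma> \<in> {-1, 1}" for \<sigma>
  proof (rule ccontr)
    assume "\<alpha> \<sigma> 0 \<noteq> 0"
    then have "\<bar>\<Sum>i\<in>{1..m \<sigma>}. \<alpha> \<sigma> i * 1\<bar> < \<alpha> \<sigma> 0"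
      using doma alpha0 s by (intro dominates_sum_le(2)) auto
    moreover have "\<alpha> \<sigma> 0 * c = (\<Sum>i\<in>{1..m \<sigma>}. \<alpha> \<sigma> i * c)"
      using bspec[OF bc s] s eta c u'0 by (auto simp: mp_boundary_condition_def)
    then have "\<alpha> \<sigma> 0 = (\<Sum>i\<in>{1..m \<sigma>}. \<alpha> \<sigma> i)" using c0 by (simp flip: sum_distrib_right)
    ultimately show False by simp
  qed
  ultimately show ?thesis using c c0 by auto
qed

section \<open>The principal eigenfunction\<close>

abbreviation mp_phase_condition ::
  "(real \<Rightarrow> nat) \<Rightarrow> (real \<Rightarrow> nat \<Rightarrow> real) \<Rightarrow> (real \<Rightarrow> nat \<Rightarrow> real) \<Rightarrow> (real \<Rightarrow> nat \<Rightarrow> real)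
    \<Rightarrow> real \<Rightarrow> real \<Rightarrow> real \<Rightarrow> bool"
  where
  "mp_phase_condition m \<alpha> \<beta> \<eta> \<nu> s \<theta> \<equiv>
    endpoint_condition {1..m \<nu>} (\<alpha> \<nu> 0) (\<nu> * \<beta> \<nu> 0) (\<alpha> \<nu>) (\<lambda>i. \<nu> * \<beta> \<nu> i) (\<lambda>i. 1 - \<nu> * \<eta> \<nu> i) s \<theta>"

text \<open>
  Seen from the right end point the sinusoid runs backwards: its phase there is \<open>\<theta> + 2 * s\<close>, and reversing
  the direction changes the sign of phase and amplitude.
\<close>

lemma sine_boundary_conditions:
  assumes eta: "\<forall>\<nu>\<in>{-1, 1}. \<forall>i\<in>{1..m \<nu>}. \<eta> \<nu> i \<in> {-1..1}"
    and C: "C \<noteq> 0"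
    and u: "\<And>x. x \<in> {-1..1} \<Longrightarrow> u x = C * sin (\<theta> + s * (1 + x))"
    and u': "\<And>x. x \<in> {-1..1} \<Longrightarrow> u' x = s * C * cos (\<theta> + s * (1 + x))"
  shows "(\<forall>\<nu>\<in>{-1, 1}. mp_boundary_condition m \<alpha> \<beta> \<eta> \<nu> u u') \<longleftrightarrow>
    mp_phase_condition m \<alpha> \<beta> \<eta> (-1) s \<theta> \<and> mp_phase_condition m \<alpha> \<beta> \<eta> 1 s (- \<theta> - 2 * s)"
proof -
  have left: "mp_boundary_condition m \<alpha> \<beta> \<eta> (-1) u u' \<longleftrightarrow> mp_phase_condition m \<alpha> \<beta> \<eta> (-1) s \<theta>"
    by (rule boundary_condition_sine[OF _ C]) (use eta u u' in auto)
  have refl: "- \<theta> - 2 * s + s * (1 - 1 * x) = - (\<theta> + s * (1 + x))" for x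
    by (simp add: algebra_simps)
  have right: "mp_boundary_condition m \<alpha> \<beta> \<eta> 1 u u' \<longleftrightarrow> mp_phase_condition m \<alpha> \<beta> \<eta> 1 s (- \<theta> - 2 * s)"
  proof (rule boundary_condition_sine[where C="- C"])
    show "u x = - C * sin (- \<theta> - 2 * s + s * (1 - 1 * x))" if "x \<in> {-1..1}" for x
      unfolding refl sin_minus using u[OF that] by simp
    show "u' x = - 1 * s * - C * cos (- \<theta> - 2 * s + s * (1 - 1 * x))" if "x \<in> {-1..1}" for x
      unfolding refl cos_minus using u'[OF that] by simp
  qed (use eta C in auto)
  show ?thesis using left right by auto
qed

lemma eigenfunction_phases:
  assumes eta: "\<forall>\<nu>\<in>{-1, 1}. \<forall>i\<in>{1..m \<nu>}. \<eta> \<nu> i \<in> {-1..1}"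
    and eig: "mp_eigenfunction m \<alpha> \<beta> \<eta> (s\<^sup>2) u" and s: "s \<noteq> 0"
  obtains C \<theta> where "C \<noteq> 0" "\<forall>x\<in>{-1..1}. u x = C * sin (\<theta> + s * (1 + x))"
    and "mp_phase_condition m \<alpha> \<beta> \<eta> (-1) s \<theta>" "mp_phase_condition m \<alpha> \<beta> \<eta> 1 s (- \<theta> - 2 * s)"
proof -
  obtain u' where nz: "\<exists>x\<in>{-1..1}. u x \<noteq> 0"
    and der: "\<forall>x\<in>{-1..1}. (u has_real_derivative u' x) (at x within {-1..1})"
      "\<forall>x\<in>{-1..1}. (u' has_real_derivative - s\<^sup>2 * u x) (at x within {-1..1})"
    and bc: "\<forall>\<nu>\<in>{-1, 1}. mp_boundary_condition m \<alpha> \<beta> \<eta> \<nu> u u'"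
    using mp_eigenfunction_derivative[OF eig] by blast
  note u = bspec[OF der(1)] and u' = bspec[OF der(2)]
  obtain C \<theta> where C: "\<forall>x\<in>{-1..1}. u x = C * sin (\<theta> + s * (1 + x))"
    "\<forall>x\<in>{-1..1}. u' x = s * C * cos (\<theta> + s * (1 + x))"
    by (rule harmonic_oscillator_solution[OF s u u'])
  have "C \<noteq> 0" using nz C(1) by auto
  have "mp_phase_condition m \<alpha> \<beta> \<eta> (-1) s \<theta> \<and> mp_phase_condition m \<alpha> \<beta> \<eta> 1 s (- \<theta> - 2 * s)"
    using sine_boundary_conditions[OF eta \<open>C \<noteq> 0\<close> bspec[OF C(1)] bspec[OF C(2)]] bc by simp
  then show thesis using that[OF \<open>C \<noteq> 0\<close> C(1)] by simp
qed

lemma sine_eigenfunction: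
  assumes eta: "\<forall>\<nu>\<in>{-1, 1}. \<forall>i\<in>{1..m \<nu>}. \<eta> \<nu> i \<in> {-1..1}"
    and nz: "sin (\<theta> + s) \<noteq> 0"
    and "mp_phase_condition m \<alpha> \<beta> \<eta> (-1) s \<theta>" "mp_phase_condition m \<alpha> \<beta> \<eta> 1 s (- \<theta> - 2 * s)"
  shows "mp_eigenfunction m \<alpha> \<beta> \<eta> (s\<^sup>2) (\<lambda>x. sin (\<theta> + s * (1 + x)))"
  unfolding mp_eigenfunction_def
proof (rule conjI, goal_cases)
  case 1
  show "\<exists>x\<in>{-1..1}. sin (\<theta> + s * (1 + x)) \<noteq> 0" using nz by (intro bexI[of _ 0]) auto
next
  case 2
  have "\<forall>\<nu>\<in>{-1, 1}. mp_boundary_condition m \<alpha> \<beta> \<eta> \<nu> (\<lambda>x. sin (\<theta> + s * (1 + x)))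
      (\<lambda>x. s * cos (\<theta> + s * (1 + x)))"
    using sine_boundary_conditions[OF eta, where C=1 and s=s and \<theta>=\<theta>] assms(3,4) by simp
  then show ?case
    by (intro exI[where x="\<lambda>x. s * cos (\<theta> + s * (1 + x))"]
        exI[where x="\<lambda>x. - s\<^sup>2 * sin (\<theta> + s * (1 + x))"])
      (auto intro!: derivative_eq_intros continuous_intros simp: power2_eq_square)
qed

lemma constant_eigenfunction:
  assumes "\<forall>\<nu>\<in>{-1, 1}. \<alpha> \<nu> 0 = 0" and "\<forall>\<nu>\<in>{-1, 1}. dominates (\<alpha> \<nu> 0) {1..m \<nu>} (\<alpha> \<nu>)"
  shows "mp_eigenfunction m \<alpha> \<beta> \<eta> 0 (\<lambda>_. 1)"
  unfolding mp_eigenfunction_def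
proof (intro conjI exI[where x="\<lambda>_. 0 :: real"])
  show "\<forall>\<nu>\<in>{-1, 1}. mp_boundary_condition m \<alpha> \<beta> \<eta> \<nu> (\<lambda>_. 1) (\<lambda>_. 0)"
    using assms by (auto simp: mp_boundary_condition_def dominates_def)
qed auto

lemma dominates_of_small:
  assumes "mp_small_coefficients m \<alpha> \<beta> \<nu>" "\<nu> \<in> {-1, 1}" "0 \<le> \<alpha> \<nu> 0" "0 \<le> \<nu> * \<beta> \<nu> 0"
  shows "dominates (\<alpha> \<nu> 0) {1..m \<nu>} (\<alpha> \<nu>)"
    and "dominates (\<nu> * \<beta> \<nu> 0) {1..m \<nu>} (\<lambda>i. \<nu> * \<beta> \<nu> i)"
proof -
  define A B where "A = (\<Sum>i=1..m \<nu>. \<bar>\<alpha> \<nu> i\<bar>)" and "B = (\<Sum>i=1..m \<nu>. \<bar>\<beta> \<nu> i\<bar>)"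
  have nu: "\<bar>\<nu>\<bar> = 1" "\<nu> \<noteq> 0" using assms(2) by auto
  have *: "\<alpha> \<nu> 0 = 0 \<Longrightarrow> A = 0" "\<beta> \<nu> 0 = 0 \<Longrightarrow> B = 0" "(A / \<alpha> \<nu> 0)\<^sup>2 + (B / \<beta> \<nu> 0)\<^sup>2 < 1"
    using assms(1) by (auto simp: mp_small_coefficients_def A_def B_def)
  have "(A / \<alpha> \<nu> 0)\<^sup>2 < 1" "(B / \<beta> \<nu> 0)\<^sup>2 < 1"
    using *(3) zero_le_power2[of "A / \<alpha> \<nu> 0"] zero_le_power2[of "B / \<beta> \<nu> 0"] by linarith+
  then have lt: "\<bar>A / \<alpha> \<nu> 0\<bar> < 1" "\<bar>B / \<beta> \<nu> 0\<bar> < 1" by (simp_all add: abs_square_less_1)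
  have "0 \<le> A" "0 \<le> B" by (auto simp: A_def B_def intro: sum_nonneg)
  have "A < \<alpha> \<nu> 0" if "\<alpha> \<nu> 0 \<noteq> 0" using lt(1) that assms(3) \<open>0 \<le> A\<close> by (simp add: field_simps)
  moreover have "\<forall>i\<in>{1..m \<nu>}. \<alpha> \<nu> i = 0" if "\<alpha> \<nu> 0 = 0"
    using *(1)[OF that] by (simp add: A_def sum_nonneg_eq_0_iff)
  ultimately show "dominates (\<alpha> \<nu> 0) {1..m \<nu>} (\<alpha> \<nu>)" by (simp add: dominates_def A_def)
  have "\<nu> * \<beta> \<nu> 0 = \<bar>\<beta> \<nu> 0\<bar>" using assms(4) nu by (metis abs_mult abs_of_nonneg mult_1)
  then have "B < \<nu> * \<beta> \<nu> 0" if "\<beta> \<nu> 0 \<noteq> 0" using lt(2) that \<open>0 \<le> B\<close> by (simp add: field_simps)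
  moreover have "\<forall>i\<in>{1..m \<nu>}. \<beta> \<nu> i = 0" if "\<beta> \<nu> 0 = 0"
    using *(2)[OF that] by (simp add: B_def sum_nonneg_eq_0_iff)
  ultimately show "dominates (\<nu> * \<beta> \<nu> 0) {1..m \<nu>} (\<lambda>i. \<nu> * \<beta> \<nu> i)"
    using nu by (simp add: dominates_def B_def abs_mult)
qed

lemma first_crossing:
  fixes H :: "real \<Rightarrow> real"
  assumes cont: "continuous_on {a..b} H" and "a \<le> b" "H a < y" "y \<le> H b"
  obtains s where "s \<in> {a<..b}" "H s = y" "\<And>t. t \<in> {a..<s} \<Longrightarrow> H t < y"
proof -
  define S where "S = {a..b} \<inter> H -` {y}"
  have "closed S" unfolding S_def
    by (intro continuous_closed_preimage cont) auto
  then have "compact ({a..b} \<inter> S)" by (intro compact_Int_closed) auto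
  then have "compact S" by (simp add: S_def)
  moreover have "S \<noteq> {}" using IVT'[of H a y b] assms by (auto simp: S_def)
  ultimately obtain s where s: "s \<in> S" "\<And>t. t \<in> S \<Longrightarrow> s \<le> t"
    using compact_attains_inf by metis
  have "H t < y" if t: "t \<in> {a..<s}" for t
  proof (rule ccontr)
    assume "\<not> H t < y"
    moreover have "continuous_on {a..t} H"
      by (rule continuous_on_subset[OF cont]) (use s t in \<open>auto simp: S_def\<close>)
    ultimately obtain r where "a \<le> r" "r \<le> t" "H r = y"
      using IVT'[of H a y t] assms t by auto
    then have "r \<in> S" using s t by (auto simp: S_def)
    then show False using s(2)[of r] \<open>r \<le> t\<close> t by auto
  qed
  moreover have "s \<in> {a<..b}" using s(1) assms by (auto simp: S_def order.order_iff_strict)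
  ultimately show thesis using that s(1) by (auto simp: S_def)
qed


theorem theorem4p15:
  fixes m :: "real \<Rightarrow> nat"
    and \<alpha> \<beta> \<eta> :: "real \<Rightarrow> nat \<Rightarrow> real"
  assumes m: "\<forall>\<nu>\<in>{-1, 1}. m \<nu> \<ge> 1"
    and eta: "\<forall>\<nu>\<in>{-1, 1}. \<forall>i\<in>{1..m \<nu>}. \<eta> \<nu> i \<in> {-1..1} \<and> \<eta> \<nu> i \<noteq> \<nu>"
    and alpha0: "\<forall>\<nu>\<in>{-1, 1}. \<alpha> \<nu> 0 \<ge> 0"
    and nontrivial: "\<forall>\<nu>\<in>{-1, 1}. \<alpha> \<nu> 0 + \<bar>\<beta> \<nu> 0\<bar> > 0"
    and beta0: "\<forall>\<nu>\<in>{-1, 1}. \<nu> * \<beta> \<nu> 0 \<ge> 0"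
    and small: "\<forall>\<nu>\<in>{-1, 1}. mp_small_coefficients m \<alpha> \<beta> \<nu>"
    and alpha: "\<forall>\<nu>\<in>{-1, 1}. \<forall>i\<in>{1..m \<nu>}. \<alpha> \<nu> i \<ge> 0"
  shows "\<exists>\<mu>\<^sub>0. mp_principal_eigenvalue m \<alpha> \<beta> \<eta> \<mu>\<^sub>0 \<and>
    (\<forall>u\<^sub>0. mp_eigenfunction m \<alpha> \<beta> \<eta> \<mu>\<^sub>0 u\<^sub>0 \<longrightarrow>
      (\<exists>c\<in>{-1, 1::real}.
         (\<forall>x\<in>{-1<..<1}. c * u\<^sub>0 x > 0) \<and>
         (\<forall>\<nu>\<in>{-1, 1}. \<beta> \<nu> 0 \<noteq> 0 \<longrightarrow> c * u\<^sub>0 \<nu> > 0)))"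
proof -
  have eta': "\<forall>\<nu>\<in>{-1, 1}. \<forall>i\<in>{1..m \<nu>}. \<eta> \<nu> i \<in> {-1..1}" using eta by blast
  have doma: "\<forall>\<nu>\<in>{-1, 1}. dominates (\<alpha> \<nu> 0) {1..m \<nu>} (\<alpha> \<nu>)"
    and domb: "\<forall>\<nu>\<in>{-1, 1}. dominates (\<nu> * \<beta> \<nu> 0) {1..m \<nu>} (\<lambda>i. \<nu> * \<beta> \<nu> i)"
    using dominates_of_small small alpha0 beta0 by blast+
  note nonpos = nonpositive_eigenvalue_constant[OF eta' alpha0 nontrivial beta0 doma domb]
  show ?thesis
  proof (cases "\<alpha> (-1) 0 = 0 \<and> \<alpha> 1 0 = 0")
    case True
    have "mp_principal_eigenvalue m \<alpha> \<beta> \<eta> 0"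
      using constant_eigenfunction[OF _ doma] True nonpos
      unfolding mp_principal_eigenvalue_def mp_eigenvalue_def by (metis insertE linear singletonD)
    moreover have "\<exists>c\<in>{-1, 1::real}. (\<forall>x\<in>{-1<..<1}. c * u x > 0) \<and>
         (\<forall>\<nu>\<in>{-1, 1}. \<beta> \<nu> 0 \<noteq> 0 \<longrightarrow> c * u \<nu> > 0)"
      if eig: "mp_eigenfunction m \<alpha> \<beta> \<eta> 0 u" for u
    proof -
      obtain c where c: "c \<noteq> 0" "\<And>x. x \<in> {-1..1} \<Longrightarrow> u x = c" using nonpos[OF eig] by auto
      show ?thesis
        by (rule bexI[of _ "sgn c"]) (use c in \<open>auto simp: sgn_if\<close>)
    qed
    ultimately show ?thesis by blast
  next
    case False
    have phase: "\<exists>\<phi>. continuous_on {0..pi/2} \<phi> \<and> (\<forall>s\<in>{0..pi/2}. 0 \<le> \<phi> s \<and> \<phi> s < pi)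
        \<and> \<phi> 0 \<le> pi/2 \<and> (\<alpha> \<nu> 0 \<noteq> 0 \<longrightarrow> \<phi> 0 = 0)
        \<and> (\<beta> \<nu> 0 \<noteq> 0 \<longrightarrow> (\<forall>s\<in>{0<..pi/2}. 0 < \<phi> s))
        \<and> (\<forall>s\<in>{0<..pi/2}. \<forall>\<theta>. mp_phase_condition m \<alpha> \<beta> \<eta> \<nu> s \<theta> \<longleftrightarrow> sin (\<theta> - \<phi> s) = 0)"
      if nu: "\<nu> \<in> {-1, 1}" for \<nu>
    proof -
      have 1: "0 \<le> \<alpha> \<nu> 0" "0 \<le> \<nu> * \<beta> \<nu> 0" "0 < \<alpha> \<nu> 0 + \<nu> * \<beta> \<nu> 0"
        using alpha0 beta0 nontrivial nu by auto
      have 2: "1 - \<nu> * \<eta> \<nu> i \<in> {0..2}" if "i \<in> {1..m \<nu>}" for i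
        using eta' nu that by fastforce
      have 3: "dominates (\<alpha> \<nu> 0) {1..m \<nu>} (\<alpha> \<nu>)"
        "dominates (\<nu> * \<beta> \<nu> 0) {1..m \<nu>} (\<lambda>i. \<nu> * \<beta> \<nu> i)"
        "\<And>i. i \<in> {1..m \<nu>} \<Longrightarrow> 0 \<le> \<alpha> \<nu> i"
        using doma domb alpha nu by blast+
      have "\<nu> \<noteq> 0" using nu by auto
      show ?thesis
        by (rule endpoint_phase[OF 1 3 2]) (use \<open>\<nu> \<noteq> 0\<close> in \<open>auto intro!: exI\<close>)
    qed
    obtain \<phi> where \<phi>: "continuous_on {0..pi/2} \<phi>" "\<forall>s\<in>{0..pi/2}. 0 \<le> \<phi> s \<and> \<phi> s < pi"
        "\<phi> 0 \<le> pi/2" "\<alpha> (-1) 0 \<noteq> 0 \<longrightarrow> \<phi> 0 = 0"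
        "\<beta> (-1) 0 \<noteq> 0 \<longrightarrow> (\<forall>s\<in>{0<..pi/2}. 0 < \<phi> s)"
        "\<forall>s\<in>{0<..pi/2}. \<forall>\<theta>. mp_phase_condition m \<alpha> \<beta> \<eta> (-1) s \<theta> \<longleftrightarrow> sin (\<theta> - \<phi> s) = 0"
      using phase[of "-1"] by blast
    obtain \<psi> where \<psi>: "continuous_on {0..pi/2} \<psi>" "\<forall>s\<in>{0..pi/2}. 0 \<le> \<psi> s \<and> \<psi> s < pi"
        "\<psi> 0 \<le> pi/2" "\<alpha> 1 0 \<noteq> 0 \<longrightarrow> \<psi> 0 = 0"
        "\<beta> 1 0 \<noteq> 0 \<longrightarrow> (\<forall>s\<in>{0<..pi/2}. 0 < \<psi> s)"
        "\<forall>s\<in>{0<..pi/2}. \<forall>\<theta>. mp_phase_condition m \<alpha> \<beta> \<eta> 1 s \<theta> \<longleftrightarrow> sin (\<theta> - \<psi> s) = 0"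
      using phase[of 1] by blast
    define H where "H s = \<phi> s + \<psi> s + 2 * s" for s
    have "continuous_on {0..pi/2} H" unfolding H_def by (intro continuous_intros \<phi>(1) \<psi>(1))
    moreover have "H 0 < pi" unfolding H_def using False \<phi>(3,4) \<psi>(3,4) pi_gt_zero by linarith
    moreover have "pi \<le> H (pi/2)" using \<phi>(2) \<psi>(2) by (auto simp: H_def)
    ultimately obtain s where s: "s \<in> {0<..pi/2}" "H s = pi" "\<And>t. t \<in> {0..<s} \<Longrightarrow> H t < pi"
      using first_crossing[of 0 "pi/2" H pi] by auto
    \<comment> \<open>The phase at the left end is \<open>\<phi> t\<close>, and the one at the right end is \<open>- \<psi> t\<close>, both modulo \<open>pi\<close>.\<close>
    have sin_H: "sin (H t) = 0"
      if "t \<in> {0<..pi/2}" "mp_phase_condition m \<alpha> \<beta> \<eta> (-1) t \<theta>" "mp_phase_condition m \<alpha> \<beta> \<eta> 1 t (- \<theta> - 2 * t)" for t \<theta>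
    proof -
      have "sin (\<theta> - \<phi> t) = 0" "sin (- \<theta> - 2 * t - \<psi> t) = 0" using \<phi>(6) \<psi>(6) that by auto
      then have "sin (- (\<theta> - \<phi> t) - (- \<theta> - 2 * t - \<psi> t)) = 0" by (simp only: sin_diff sin_minus)
      then show ?thesis by (simp add: H_def algebra_simps)
    qed
    have below: "s\<^sup>2 \<le> \<mu>" if eig: "mp_eigenfunction m \<alpha> \<beta> \<eta> \<mu> u" for \<mu> u
    proof (rule ccontr)
      assume "\<not> s\<^sup>2 \<le> \<mu>"
      moreover have "0 < \<mu>" using nonpos[OF eig] False by linarith
      ultimately have t: "0 < sqrt \<mu>" "sqrt \<mu> < s" "\<mu> = (sqrt \<mu>)\<^sup>2"
        using s(1) by (auto intro: real_less_lsqrt)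
      have "mp_eigenfunction m \<alpha> \<beta> \<eta> ((sqrt \<mu>)\<^sup>2) u" using eig t(3) by simp
      then obtain \<theta> where "mp_phase_condition m \<alpha> \<beta> \<eta> (-1) (sqrt \<mu>) \<theta>"
        "mp_phase_condition m \<alpha> \<beta> \<eta> 1 (sqrt \<mu>) (- \<theta> - 2 * sqrt \<mu>)"
        by (rule eigenfunction_phases[OF eta']) (use t in auto)
      then have "sin (H (sqrt \<mu>)) = 0" using sin_H t s(1) by auto
      moreover have "0 < H (sqrt \<mu>)" "H (sqrt \<mu>) < pi"
        using s t \<phi>(2) \<psi>(2) by (auto simp: H_def add_nonneg_pos)
      ultimately show False using sin_gt_zero by fastforce
    qed
    have \<phi>s: "0 \<le> \<phi> s" "0 \<le> \<psi> s" "\<phi> s < pi" "\<psi> s < pi" "0 < s" "\<phi> s + \<psi> s + 2 * s = pi"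
      using \<phi>(2) \<psi>(2) s by (auto simp: H_def)
    have "sin (\<phi> s + s) > 0" using \<phi>s by (intro sin_gt_zero) auto
    moreover have "- \<phi> s - 2 * s - \<psi> s = - pi" using \<phi>s(6) by simp
    ultimately have "mp_eigenfunction m \<alpha> \<beta> \<eta> (s\<^sup>2) (\<lambda>x. sin (\<phi> s + s * (1 + x)))"
      using \<phi>(6) \<psi>(6) s(1) by (intro sine_eigenfunction[OF eta']) auto
    then have "mp_principal_eigenvalue m \<alpha> \<beta> \<eta> (s\<^sup>2)"
      using below by (auto simp: mp_principal_eigenvalue_def mp_eigenvalue_def)
    moreover have "\<exists>c\<in>{-1, 1::real}. (\<forall>x\<in>{-1<..<1}. c * u x > 0) \<and>
         (\<forall>\<nu>\<in>{-1, 1}. \<beta> \<nu> 0 \<noteq> 0 \<longrightarrow> c * u \<nu> > 0)"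
      if eig: "mp_eigenfunction m \<alpha> \<beta> \<eta> (s\<^sup>2) u" for u
    proof -
      obtain C \<theta> where C: "C \<noteq> 0" "\<forall>x\<in>{-1..1}. u x = C * sin (\<theta> + s * (1 + x))"
        "mp_phase_condition m \<alpha> \<beta> \<eta> (-1) s \<theta>"
        by (rule eigenfunction_phases[OF eta' eig]) (use \<phi>s(5) in auto)
      have sin0: "sin (\<theta> - \<phi> s) = 0" using \<phi>(6) C(3) s(1) by auto
      \<comment> \<open>\<open>\<theta>\<close> and \<open>\<phi> s\<close> differ by a multiple of \<open>pi\<close>, so replacing one by the other only affects the sign.\<close>
      define D where "D = C * cos (\<theta> - \<phi> s)"
      have D: "D \<noteq> 0" using C(1) sin0 sin_zero_abs_cos_one[OF sin0] by (auto simp: D_def)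
      have u: "u x = D * sin (\<phi> s + s * (1 + x))" if "x \<in> {-1..1}" for x
      proof -
        have "\<theta> + s * (1 + x) = (\<theta> - \<phi> s) + (\<phi> s + s * (1 + x))" by simp
        then show ?thesis using bspec[OF C(2) that] sin0 by (simp only: sin_add[of "\<theta> - \<phi> s"] D_def) simp
      qed
      have "0 < sin (\<phi> s + s * (1 + x))" if "x \<in> {-1<..<1}" for x
      proof (rule sin_gt_zero)
        have "s * (1 + x) < s * 2" "0 < s * (1 + x)" using that \<phi>s(5) by auto
        then show "0 < \<phi> s + s * (1 + x)" "\<phi> s + s * (1 + x) < pi" using \<phi>s by linarith+
      qed
      moreover have "0 < sin (\<phi> s)" if "\<beta> (-1) 0 \<noteq> 0"
        using that \<phi>(5) s(1) \<phi>s(3) by (intro sin_gt_zero) auto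
      moreover have "0 < sin (\<phi> s + s * 2)" if "\<beta> 1 0 \<noteq> 0"
      proof -
        have "\<phi> s + s * 2 = pi - \<psi> s" using \<phi>s(6) by simp
        then show ?thesis using that \<psi>(5) s(1) \<phi>s(4) by (simp add: sin_gt_zero)
      qed
      ultimately show ?thesis using D
        by (intro bexI[of _ "sgn D"]) (auto simp: u sgn_if zero_less_mult_iff mult_less_0_iff)
    qed
    ultimately show ?thesis by blast
  qed
qed

end
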